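(* Every regular $2$-balanced $6$-partite tournament has a strong partition.
   Context: A $2$-balanced $6$-partite tournament is an orientation of the complete $6$-partite graph with all parts of size $2$; it is regular if every vertex has in-degree equal to out-degree. A partition into maximal tournaments is a pair of vertex-disjoint tournaments of order $6$ covering all vertices (each containing one vertex from each partite set); it is a strong partition if both tournaments are strongly connected. *)

theory Defs
  imports "HOL-Library.Disjoint_Sets" "Graph_Theory.Digraph_Component"
begin

text \<open>
  The locale \<^locale>\<open>digraph\<close> provides finiteness and the absence of loops and parallel arcs.
  A disequality between truth values such as
  \<open>(u \<rightarrow>\<^bsub>G\<^esub> v) \<noteq> (v \<rightarrow>\<^bsub>G\<^esub> u)\<close> is an exclusive or:
  exactly one of the two arcs is present.
\<close>

definition tournament :: "('a, 'b) pre_digraph \<Rightarrow> bool" where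
  "tournament T \<longleftrightarrow>
     digraph T \<and>
     (\<forall>u\<in>verts T. \<forall>v\<in>verts T. u \<noteq> v \<longrightarrow> (u \<rightarrow>\<^bsub>T\<^esub> v) \<noteq> (v \<rightarrow>\<^bsub>T\<^esub> u))"

text \<open>
  An orientation of the complete multipartite graph whose set of partite sets is \<open>P\<close>.
\<close>

definition multipartite_tournament :: "('a, 'b) pre_digraph \<Rightarrow> 'a set set \<Rightarrow> bool" where
  "multipartite_tournament G P \<longleftrightarrow>
     digraph G \<and> partition_on (verts G) P \<and>
     (\<forall>X\<in>P. \<forall>u\<in>X. \<forall>v\<in>X. \<not> (u \<rightarrow>\<^bsub>G\<^esub> v)) \<and>
     (\<forall>X\<in>P. \<forall>Y\<in>P. X \<noteq> Y \<longrightarrow> (\<forall>u\<in>X. \<forall>v\<in>Y. (u \<rightarrow>\<^bsub>G\<^esub> v) \<noteq> (v \<rightarrow>\<^bsub>G\<^esub> u)))"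

text \<open>An \<open>r\<close>-balanced \<open>c\<close>-partite tournament.\<close>

definition balanced_multipartite_tournament ::
    "nat \<Rightarrow> nat \<Rightarrow> ('a, 'b) pre_digraph \<Rightarrow> 'a set set \<Rightarrow> bool" where
  "balanced_multipartite_tournament r c G P \<longleftrightarrow>
     multipartite_tournament G P \<and> card P = c \<and> (\<forall>X\<in>P. card X = r)"

definition regular_digraph :: "('a, 'b) pre_digraph \<Rightarrow> bool" where
  "regular_digraph G \<longleftrightarrow> (\<forall>v\<in>verts G. in_degree G v = out_degree G v)"

text \<open>
  The last conjunct follows from the others when \<open>G\<close> is a multipartite tournament with
  partite sets \<open>P\<close>; it is stated because it is part of the usual description.
\<close>

definition maximal_tournament ::
    "('a, 'b) pre_digraph \<Rightarrow> 'a set set \<Rightarrow> ('a, 'b) pre_digraph \<Rightarrow> bool" where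
  "maximal_tournament G P T \<longleftrightarrow>
     subgraph T G \<and> tournament T \<and> card (verts T) = card P \<and>
     (\<forall>X\<in>P. card (verts T \<inter> X) = 1)"

text \<open>
  In the \<open>2\<close>-balanced case a partition into maximal tournaments consists of two tournaments.
\<close>

definition maximal_tournament_partition ::
    "('a, 'b) pre_digraph \<Rightarrow> 'a set set \<Rightarrow>
     ('a, 'b) pre_digraph \<Rightarrow> ('a, 'b) pre_digraph \<Rightarrow> bool" where
  "maximal_tournament_partition G P T1 T2 \<longleftrightarrow>
     maximal_tournament G P T1 \<and> maximal_tournament G P T2 \<and>
     verts T1 \<inter> verts T2 = {} \<and> verts T1 \<union> verts T2 = verts G"

definition strong_partition ::
    "('a, 'b) pre_digraph \<Rightarrow> 'a set set \<Rightarrow>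
     ('a, 'b) pre_digraph \<Rightarrow> ('a, 'b) pre_digraph \<Rightarrow> bool" where
  "strong_partition G P T1 T2 \<longleftrightarrow>
     maximal_tournament_partition G P T1 T2 \<and>
     strongly_connected T1 \<and> strongly_connected T2"

end

theory Submission
  imports Defs
begin

text \<open>
  A tournament of order 6 that is not strong has a source, a sink, or consists of a cyclic triangle
  dominating another one. Every vertex has out-degree 5 over five foreign parts; call it balanced if
  it has one out-neighbour in each of them. Among the 64 transversals, a vertex is the source of at
  most one and lies on the dominating triangle of at most two if it is balanced, and otherwise it is
  never a source and lies on the dominating triangle of at most four; dually for sinks and dominated
  triangles. Giving weight 6 to sources and sinks and weight 1 to the six vertices of the triangles,
  every non-strong transversal has weight at least 6, while a vertex receives at most 16, and at most
  8 if it is not balanced. So at most \<open>12 * 16 / 6 = 32\<close> transversals are not strong, and fewer if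
  some vertex is not balanced. If all vertices are balanced, then a vertex with its out-neighbours is
  a transversal with a source, and so is its complement. In either case the non-strong transversals
  do not meet all 32 complementary pairs.
\<close>

section \<open>Transversals, sources and dominating triangles\<close>

definition transversals :: "'a set \<Rightarrow> ('a \<Rightarrow> 'a) \<Rightarrow> 'a set set" where
  "transversals V mate = {S. S \<subseteq> V \<and> (\<forall>v\<in>V. v \<in> S \<longleftrightarrow> mate v \<notin> S)}"

text \<open>Applied to the converse relation, this describes a sink.\<close>

definition source :: "('a \<Rightarrow> 'a \<Rightarrow> bool) \<Rightarrow> 'a \<Rightarrow> 'a set \<Rightarrow> bool" where
  "source E v S \<longleftrightarrow> v \<in> S \<and> (\<forall>y\<in>S - {v}. E v y)"

text \<open>The triangle is traversed from \<open>v\<close>, so \<open>k\<close> is the in-neighbour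
  of \<open>v\<close> on it. For the converse relation it is a dominated triangle.\<close>

definition on_initial_cycle :: "('a \<Rightarrow> 'a \<Rightarrow> bool) \<Rightarrow> 'a \<Rightarrow> 'a set \<Rightarrow> bool" where
  "on_initial_cycle E v S \<longleftrightarrow>
     (\<exists>x k. {v, x, k} \<subseteq> S \<and> E v x \<and> E x k \<and> E k v \<and>
        (\<forall>y\<in>S - {v, x, k}. E v y \<and> E x y \<and> E k y))"

lemma on_initial_cycleI:
  assumes "{v, x, k} \<subseteq> S" "E v x" "E x k" "E k v"
    and "\<And>q y. q \<in> {v, x, k} \<Longrightarrow> y \<in> S - {v, x, k} \<Longrightarrow> E q y"
  shows "on_initial_cycle E v S"
  unfolding on_initial_cycle_def using assms by blast

text \<open>In a tournament this is the failure of strong connectivity: no arc leads back into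
  \<open>Q\<close>.\<close>

definition dominance_split :: "('a \<Rightarrow> 'a \<Rightarrow> bool) \<Rightarrow> 'a set \<Rightarrow> bool" where
  "dominance_split E S \<longleftrightarrow>
     (\<exists>Q. Q \<noteq> {} \<and> Q \<subset> S \<and> (\<forall>x\<in>Q. \<forall>y\<in>S - Q. E x y))"

lemma card_ge_3_if_no_source:
  assumes "finite A" "A \<noteq> {}"
    and tour: "\<And>u v. u \<in> A \<Longrightarrow> v \<in> A \<Longrightarrow> u \<noteq> v \<Longrightarrow> E u v \<noteq> E v u"
    and no_source: "\<And>v. \<not> source E v A"
  shows "3 \<le> card A"
proof (rule ccontr)
  assume "\<not> 3 \<le> card A"
  moreover have "card A \<noteq> 0"
    using assms(1,2) by simp
  ultimately have "card A = 1 \<or> card A = 2"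
    by linarith
  \<comment> \<open>Allowing \<open>a = b\<close> covers both cardinalities at once.\<close>
  then obtain a b where A: "A = {a, b}"
    by (metis card_1_singletonE card_2_iff insert_absorb2)
  then have "source E a A \<or> source E b A"
    using tour[of a b] unfolding source_def by auto
  with no_source show False
    by blast
qed

text \<open>No vertex dominates the other two, so the three arcs have different tails, which leaves
  only the two cyclic orientations.\<close>

lemma cyclic_triple_if_no_source:
  assumes "card A = 3" "v \<in> A"
    and tour: "\<And>u v. u \<in> A \<Longrightarrow> v \<in> A \<Longrightarrow> u \<noteq> v \<Longrightarrow> E u v \<noteq> E v u"
    and no_source: "\<And>v. \<not> source E v A"
  obtains x k where "A = {v, x, k}" "E v x" "E x k" "E k v"
proof -
  have "card (A - {v}) = 2"
    using assms(1,2) by (simp add: card_ge_0_finite)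
  then obtain a b where "A - {v} = {a, b}" and "a \<noteq> b"
    by (meson card_2_iff)
  then have A: "A = {v, a, b}" and neq: "v \<noteq> a" "v \<noteq> b" "a \<noteq> b"
    using \<open>v \<in> A\<close> by blast+
  have "E v a \<noteq> E a v" "E v b \<noteq> E b v" "E a b \<noteq> E b a"
    using tour[of v a] tour[of v b] tour[of a b] A neq by simp_all
  moreover have "\<not> (E v a \<and> E v b)" "\<not> (E a v \<and> E a b)" "\<not> (E b v \<and> E b a)"
    using no_source[of v] no_source[of a] no_source[of b] A by (auto simp: source_def)
  ultimately have "E v a \<and> E a b \<and> E b v \<or> E v b \<and> E b a \<and> E a v"
    by blast
  then show thesis
    using that[of a b] that[of b a] A by (auto simp: insert_commute)
qed

text \<open>The parts are the pairs \<open>{v, mate v}\<close>.\<close>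

locale regular_bipaired_tournament =
  fixes V :: "'a set" and mate :: "'a \<Rightarrow> 'a" and E :: "'a \<Rightarrow> 'a \<Rightarrow> bool"
  assumes card_V: "card V = 12"
    and mate_in: "v \<in> V \<Longrightarrow> mate v \<in> V"
    and mate_mate: "v \<in> V \<Longrightarrow> mate (mate v) = v"
    and mate_neq: "v \<in> V \<Longrightarrow> mate v \<noteq> v"
    and E_in: "E u v \<Longrightarrow> u \<in> V \<and> v \<in> V \<and> v \<noteq> u \<and> v \<noteq> mate u"
    and E_xor: "u \<in> V \<Longrightarrow> v \<in> V \<Longrightarrow> v \<noteq> u \<Longrightarrow> v \<noteq> mate u \<Longrightarrow> E u v \<noteq> E v u"
    and card_out: "v \<in> V \<Longrightarrow> card {u. E v u} = 5"
    and card_in: "v \<in> V \<Longrightarrow> card {u. E u v} = 5"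
begin

section \<open>Duality and the number of transversals\<close>

lemma finite_V: "finite V"
  using card_V by (simp add: card_ge_0_finite)

lemma finite_out: "finite {u. E v u}" and finite_in: "finite {u. E u v}"
  using E_in by (auto intro: finite_subset[OF _ finite_V])

lemma E_asym: "E u v \<Longrightarrow> \<not> E v u"
  using E_xor E_in by blast

lemma mate_eq_iff: "u \<in> V \<Longrightarrow> v \<in> V \<Longrightarrow> u = mate v \<longleftrightarrow> v = mate u"
  using mate_mate by metis

text \<open>In- and out-degrees are both 5, so reversing all arcs preserves the axioms. Bounds for
  sources and dominating triangles thereby hold for sinks and dominated triangles.\<close>

lemma converse_regular_bipaired_tournament: "regular_bipaired_tournament V mate E\<inverse>\<inverse>"
proof
  fix u v
  show "E\<inverse>\<inverse> u v \<Longrightarrow> u \<in> V \<and> v \<in> V \<and> v \<noteq> u \<and> v \<noteq> mate u"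
    using E_in mate_eq_iff by (metis conversep_iff)
  show "u \<in> V \<Longrightarrow> v \<in> V \<Longrightarrow> v \<noteq> u \<Longrightarrow> v \<noteq> mate u \<Longrightarrow> E\<inverse>\<inverse> u v \<noteq> E\<inverse>\<inverse> v u"
    using E_xor by (metis conversep_iff)
qed (simp_all add: card_V mate_in mate_mate mate_neq card_out card_in)

abbreviation "Tr \<equiv> transversals V mate"

lemma finite_Tr: "finite Tr"
  by (rule finite_subset[of _ "Pow V"]) (auto simp: transversals_def finite_V)

lemma TrD:
  assumes "S \<in> Tr"
  shows "S \<subseteq> V" "v \<in> V \<Longrightarrow> v \<in> S \<longleftrightarrow> mate v \<notin> S" "finite S"
  using assms finite_V by (auto simp: transversals_def intro: finite_subset)

text \<open>\<open>mate\<close> maps \<open>S\<close> bijectively onto its complement in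
  \<open>V\<close>.\<close>

lemma card_Tr_elem:
  assumes "S \<in> Tr"
  shows "card S = 6"
proof -
  note TrD[OF assms]
  have inj: "inj_on mate S"
    using \<open>S \<subseteq> V\<close> mate_mate by (intro inj_onI) (metis subsetD)
  have "V = S \<union> mate ` S"
  proof
    show "V \<subseteq> S \<union> mate ` S"
      using \<open>\<And>v. v \<in> V \<Longrightarrow> v \<in> S \<longleftrightarrow> mate v \<notin> S\<close> mate_in mate_mate by (metis UnCI imageI subsetI)
    show "S \<union> mate ` S \<subseteq> V"
      using \<open>S \<subseteq> V\<close> mate_in by auto
  qed
  moreover have "S \<inter> mate ` S = {}"
    using \<open>\<And>v. v \<in> V \<Longrightarrow> v \<in> S \<longleftrightarrow> mate v \<notin> S\<close> \<open>S \<subseteq> V\<close> by auto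
  ultimately have "card V = card S + card S"
    using card_image[OF inj] \<open>finite S\<close> by (metis card_Un_disjoint finite_imageI)
  then show ?thesis
    using card_V by simp
qed

lemma Diff_in_Tr: "S \<in> Tr \<Longrightarrow> V - S \<in> Tr"
  using mate_in by (auto simp: transversals_def)

text \<open>From one fixed transversal \<open>R\<close> of size 6, each subset \<open>A\<close>
  yields another one: keep \<open>A\<close> and replace the other vertices by their mates.
  Intersecting with \<open>R\<close> recovers \<open>A\<close>.\<close>

lemma card_Tr_ge: "64 \<le> card Tr"
proof -
  \<comment> \<open>The choice depends only on the set \<open>{v, mate v}\<close>, hence it selects
    one representative per pair.\<close>
  define r where "r v = (SOME x. x \<in> {v, mate v})" for v
  have r: "r v = v \<or> r v = mate v" for v
    using someI[of "\<lambda>x. x \<in> {v, mate v}" v] by (auto simp: r_def)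
  have r_mate: "r (mate v) = r v" if "v \<in> V" for v
    using mate_mate[OF that] by (simp add: r_def insert_commute)
  define R where "R = {v \<in> V. r v = v}"
  have R: "R \<in> Tr"
    unfolding transversals_def R_def mem_Collect_eq
  proof (intro conjI ballI)
    fix v assume "v \<in> V"
    then show "(v \<in> V \<and> r v = v) = (\<not> (mate v \<in> V \<and> r (mate v) = mate v))"
      using r[of v] r_mate mate_in mate_neq by metis
  qed auto
  note R' = TrD[OF R]
  define f where "f A = A \<union> mate ` (R - A)" for A
  have "f A \<in> Tr" if "A \<subseteq> R" for A
    unfolding transversals_def
  proof (intro CollectI conjI ballI)
    show "f A \<subseteq> V"
      using that R' mate_in by (auto simp: f_def)
  next
    fix v assume "v \<in> V"
    have "v \<in> mate ` (R - A) \<longleftrightarrow> mate v \<in> R - A" if "v \<in> V" for v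
      using that R'(1) mate_mate by force
    then show "v \<in> f A \<longleftrightarrow> mate v \<notin> f A"
      using \<open>v \<in> V\<close> R'(2)[OF \<open>v \<in> V\<close>] that mate_in mate_mate by (auto simp: f_def)
  qed
  moreover have "inj_on f (Pow R)"
  proof (rule inj_on_inverseI)
    fix A assume "A \<in> Pow R"
    then show "f A \<inter> R = A"
      using R' by (auto simp: f_def)
  qed
  ultimately have "card (Pow R) \<le> card Tr"
    by (intro card_inj_on_le[of f] finite_Tr) auto
  then show ?thesis
    using card_Tr_elem[OF R] \<open>finite R\<close> by (simp add: card_Pow)
qed

section \<open>Balanced vertices\<close>

text \<open>Stating the condition on \<open>mate u\<close> as an arc into \<open>v\<close> makes it
  symmetric under reversal of arcs, as replacing \<open>u\<close> by \<open>mate u\<close>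
  shows.\<close>

definition balanced :: "'a \<Rightarrow> bool" where
  "balanced v \<longleftrightarrow> (\<forall>u\<in>V - {v, mate v}. E v u \<longleftrightarrow> E (mate u) v)"

lemma E_not_out: "v \<in> V \<Longrightarrow> u \<in> V - {v, mate v} \<Longrightarrow> \<not> E v u \<longleftrightarrow> E u v"
  using E_xor[of v u] by blast

lemma mate_in_Diff: "v \<in> V \<Longrightarrow> u \<in> V - {v, mate v} \<Longrightarrow> mate u \<in> V - {v, mate v}"
  using mate_in mate_mate by (metis DiffE DiffI empty_iff insert_iff)

text \<open>If no pair consists of out-neighbours of \<open>v\<close>, then \<open>mate\<close> maps
  the five out-neighbours injectively into the five in-neighbours, hence onto them, and
  \<open>v\<close> is balanced. The same argument works with the roles exchanged.\<close>

lemma not_balancedE: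
  assumes "v \<in> V" "\<not> balanced v"
  obtains j z where "E v j" "E v (mate j)" "E z v" "E (mate z) v"
proof -
  have inj: "inj_on mate W" if "W \<subseteq> V" for W
    using that mate_mate by (intro inj_onI) (metis subsetD)
  let ?O = "{u. E v u}" and ?I = "{u. E u v}"
  have cO: "card ?O = 5" and cI: "card ?I = 5"
    using card_out card_in assms by auto
  have O_V: "?O \<subseteq> V - {v, mate v}" and I_V: "?I \<subseteq> V - {v, mate v}"
    using E_in mate_eq_iff \<open>v \<in> V\<close> by blast+
  have bal: "mate ` ?O = ?I \<Longrightarrow> balanced v"
    unfolding balanced_def using O_V I_V mate_mate E_in
    by (smt (verit, ccfv_threshold) DiffD1 image_iff mem_Collect_eq mate_in)
  have "\<exists>j. E v j \<and> E v (mate j)"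
  proof (rule ccontr)
    assume "\<nexists>j. E v j \<and> E v (mate j)"
    then have "mate ` ?O \<subseteq> ?I"
      using O_V mate_in_Diff[OF \<open>v \<in> V\<close>] E_not_out[OF \<open>v \<in> V\<close>] by blast
    moreover have "card (mate ` ?O) = 5"
      using inj[of ?O] O_V cO by (subst card_image) auto
    ultimately have "mate ` ?O = ?I"
      using cI finite_in by (intro card_subset_eq) auto
    with bal assms show False
      by blast
  qed
  moreover have "\<exists>z. E z v \<and> E (mate z) v"
  proof (rule ccontr)
    assume "\<nexists>z. E z v \<and> E (mate z) v"
    then have *: "mate ` ?I \<subseteq> ?O"
      using I_V mate_in_Diff[OF \<open>v \<in> V\<close>] E_not_out[OF \<open>v \<in> V\<close>] by blast
    moreover have "card (mate ` ?I) = 5"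
      using inj[of ?I] I_V cI by (subst card_image) auto
    ultimately have "mate ` ?I = ?O"
      using cO finite_out by (intro card_subset_eq) auto
    then have "mate ` ?O = mate ` mate ` ?I"
      by simp
    also have "\<dots> = ?I"
      using I_V mate_mate by (force simp: image_image)
    finally show False
      using bal assms by blast
  qed
  ultimately show thesis
    using that by blast
qed

section \<open>Transversals with a given source or a given vertex on the dominating triangle\<close>

text \<open>A source has five out-neighbours inside \<open>S\<close>, which exhausts its
  out-degree.\<close>

lemma source_eq:
  assumes "S \<in> Tr" "source E v S"
  shows "S = insert v {u. E v u}"
proof -
  have "v \<in> S" "v \<in> V"
    using assms TrD(1) by (auto simp: source_def)
  have "S - {v} \<subseteq> {u. E v u}"
    using assms by (auto simp: source_def)
  moreover have "card (S - {v}) = 5"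
    using card_Tr_elem[OF \<open>S \<in> Tr\<close>] TrD(3)[OF \<open>S \<in> Tr\<close>] \<open>v \<in> S\<close> by simp
  ultimately have "S - {v} = {u. E v u}"
    using card_out[OF \<open>v \<in> V\<close>] finite_out by (intro card_subset_eq) auto
  with \<open>v \<in> S\<close> show ?thesis
    by blast
qed

lemma card_sources: "card {S \<in> Tr. source E v S} \<le> 1"
proof -
  have "{S \<in> Tr. source E v S} \<subseteq> {insert v {u. E v u}}"
    using source_eq by blast
  then show ?thesis
    by (metis card_mono card.empty card_insert_disjoint empty_iff finite.simps One_nat_def)
qed

text \<open>Some pair consists of in-neighbours of \<open>v\<close>, and every transversal meets
  it.\<close>

lemma not_balanced_no_source:
  assumes "v \<in> V" "\<not> balanced v" "S \<in> Tr"
  shows "\<not> source E v S"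
proof
  assume *: "source E v S"
  obtain z where z: "E z v" "E (mate z) v"
    using not_balancedE assms by metis
  have "z \<in> S \<or> mate z \<in> S"
    using TrD(2)[OF \<open>S \<in> Tr\<close>, of z] E_in[OF z(1)] by blast
  with * z show False
    using E_asym E_in unfolding source_def by (metis DiffI singletonD)
qed

text \<open>In \<open>S\<close> only the triangle vertex \<open>k\<close> dominates
  \<open>v\<close>, so \<open>S\<close> consists of \<open>v\<close> and its out-neighbours with
  \<open>mate k\<close> exchanged for \<open>k\<close>. It remains to exclude three possible values
  of \<open>k\<close>.\<close>

lemma card_initial_balanced:
  assumes "v \<in> V" "balanced v"
  shows "card {S \<in> Tr. on_initial_cycle E v S} \<le> 2"
proof -
  let ?O = "{u. E v u}"
  have cO: "card ?O = 5"
    using card_out assms by auto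
  \<comment> \<open>The possible in-neighbours of \<open>v\<close> on the triangle; such a \<open>k\<close> determines the transversal.\<close>
  define K where "K = {k. E k v \<and> (\<exists>x. E v x \<and> E x k \<and>
    (\<forall>y\<in>?O - {mate k, x}. E x y \<and> E k y))}"
  have "finite K"
    using finite_in[of v] by (rule rev_finite_subset) (auto simp: K_def)
  have "{S \<in> Tr. on_initial_cycle E v S} \<subseteq> (\<lambda>k. {v, k} \<union> (?O - {mate k})) ` K"
  proof
    fix S assume "S \<in> {S \<in> Tr. on_initial_cycle E v S}"
    then have S: "S \<in> Tr" and "on_initial_cycle E v S"
      by auto
    then obtain x k where xk: "{v, x, k} \<subseteq> S" "E v x" "E x k" "E k v"
      and dom: "\<forall>y\<in>S - {v, x, k}. E v y \<and> E x y \<and> E k y"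
      by (auto simp: on_initial_cycle_def)
    have "k \<in> V" "v \<noteq> k" "mate k \<notin> S"
      using xk E_in TrD[OF S] by auto
    have "k \<in> V - {v, mate v}"
      using E_in[OF \<open>E k v\<close>] mate_mate \<open>v \<in> V\<close> by auto
    then have mk: "E v (mate k)"
      using \<open>balanced v\<close> E_not_out[OF \<open>v \<in> V\<close>] mate_in_Diff[OF \<open>v \<in> V\<close>] mate_mate \<open>E k v\<close>
      unfolding balanced_def by (metis DiffD1)
    have "S - {v, k} \<subseteq> ?O - {mate k}"
      using dom xk \<open>mate k \<notin> S\<close> by auto
    moreover have "card (S - {v, k}) = 4"
      using card_Tr_elem[OF S] TrD(3)[OF S] xk(1) \<open>v \<noteq> k\<close> by (subst card_Diff_subset) auto
    moreover have "card (?O - {mate k}) = 4"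
      using cO mk finite_out by simp
    ultimately have eq: "S - {v, k} = ?O - {mate k}"
      using finite_out by (intro card_subset_eq) auto
    then have "S = {v, k} \<union> (?O - {mate k})"
      using xk(1) by blast
    moreover have "k \<in> K"
      unfolding K_def using xk dom eq by (intro CollectI conjI exI[of _ x]) auto
    ultimately show "S \<in> (\<lambda>k. {v, k} \<union> (?O - {mate k})) ` K"
      by blast
  qed
  then have "card {S \<in> Tr. on_initial_cycle E v S} \<le> card K"
    using \<open>finite K\<close> by (meson card_image_le card_mono finite_imageI order_trans)
  \<comment> \<open>With three choices of \<open>k\<close>, the third vertices \<open>x k\<close> of the triangles are distinct and are the
    mates of the three \<open>k\<close>; then any other out-neighbour of \<open>v\<close> has in-degree at least 7.\<close>
  moreover have "\<not> 3 \<le> card K"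
  proof
    assume "3 \<le> card K"
    then obtain k1 k2 k3 where k: "k1 \<in> K" "k2 \<in> K" "k3 \<in> K"
      and k_neq: "k1 \<noteq> k2" "k1 \<noteq> k3" "k2 \<noteq> k3"
      by (metis obtain_subset_with_card_n card_3_iff insert_subset)
    have "\<exists>x. \<forall>k\<in>K. E v (x k) \<and> E (x k) k \<and> (\<forall>y\<in>?O - {mate k, x k}. E (x k) y \<and> E k y)"
      by (intro bchoice) (auto simp: K_def)
    then obtain x where x: "\<And>k. k \<in> K \<Longrightarrow> E v (x k)" "\<And>k. k \<in> K \<Longrightarrow> E (x k) k"
      and dom: "\<And>k y. k \<in> K \<Longrightarrow> E v y \<Longrightarrow> y \<noteq> mate k \<Longrightarrow> y \<noteq> x k \<Longrightarrow> E (x k) y \<and> E k y"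
      by blast
    have kv: "E k v" "k \<in> V" if "k \<in> K" for k
      using that E_in by (auto simp: K_def)
    have inj: "x k \<noteq> x l" if "k \<in> K" "l \<in> K" "k \<noteq> l" for k l
    proof
      assume eq: "x k = x l"
      have "mate k \<noteq> mate l"
        using kv mate_mate that by metis
      \<comment> \<open>Every out-neighbour of \<open>v\<close> other than \<open>x k\<close>
        differs from \<open>mate k\<close> or from \<open>mate l\<close>, so the common vertex
        dominates it. Together with \<open>k\<close> and \<open>l\<close> this gives out-degree at
        least 6.\<close>
      then have "(?O - {x k}) \<union> {k, l} \<subseteq> {u. E (x k) u}"
        using dom[of k] dom[of l] x[of k] x[of l] that eq by auto
      then have "card ((?O - {x k}) \<union> {k, l}) \<le> 5"
        using card_out[of "x k"] E_in[OF x(1)[of k]] that finite_out card_mono by metis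
      moreover have "(?O - {x k}) \<inter> {k, l} = {}"
        using kv that E_asym by auto
      then have "card ((?O - {x k}) \<union> {k, l}) = card (?O - {x k}) + card {k, l}"
        using finite_out by (intro card_Un_disjoint) auto
      moreover have "card (?O - {x k}) = 4"
        using x(1)[of k] that cO finite_out by simp
      ultimately show False
        using \<open>k \<noteq> l\<close> by simp
    qed
    \<comment> \<open>If neither equation held, \<open>x k\<close> and \<open>x l\<close> would
      dominate each other.\<close>
    have pair: "x l = mate k \<or> x k = mate l" if "k \<in> K" "l \<in> K" "k \<noteq> l" for k l
      using dom[of k "x l"] dom[of l "x k"] inj[OF that] x(1) that E_asym by metis
    have "mate k1 \<noteq> mate k2" "mate k1 \<noteq> mate k3" "mate k2 \<noteq> mate k3"
      using kv k k_neq mate_mate by metis+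
    \<comment> \<open>The values of \<open>x\<close> are distinct, so no mate can occur in two of
      the three equations given by \<open>pair\<close>. Hence all three mates occur.\<close>
    then have mates: "{mate k1, mate k2, mate k3} \<subseteq> {x k1, x k2, x k3}"
      using pair[of k1 k2] pair[of k1 k3] pair[of k2 k3] k k_neq
        inj[of k1 k2] inj[of k1 k3] inj[of k2 k3] by auto
    have "card {x k1, x k2, x k3} \<le> 3"
      using card_length[of "[x k1, x k2, x k3]"] by simp
    then have "\<not> ?O \<subseteq> {x k1, x k2, x k3}"
      using card_mono[of "{x k1, x k2, x k3}" ?O] cO by auto
    then obtain y where y: "E v y" "y \<notin> {x k1, x k2, x k3}"
      by blast
    then have "{v, x k1, x k2, x k3, k1, k2, k3} \<subseteq> {u. E u y}"
      using dom k mates by auto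
    then have "card {v, x k1, x k2, x k3, k1, k2, k3} \<le> 5"
      using card_in[of y] E_in[OF y(1)] finite_in card_mono by metis
    moreover have "x k \<noteq> v \<and> x k \<noteq> l \<and> l \<noteq> v" if "k \<in> K" "l \<in> K" for k l
      using x(1) kv(1) that E_asym by metis
    then have "distinct [v, x k1, x k2, x k3, k1, k2, k3]"
      using k k_neq inj by simp metis
    then have "card {v, x k1, x k2, x k3, k1, k2, k3} = 7"
      using distinct_card by fastforce
    ultimately show False
      by linarith
  qed
  ultimately show ?thesis
    by linarith
qed

text \<open>\<open>S\<close> meets the pair of in-neighbours \<open>z\<close>, \<open>mate z\<close>
  only in the triangle vertex \<open>k\<close>, and the pair of out-neighbours \<open>j\<close>,
  \<open>mate j\<close> in one vertex \<open>i\<close>. Besides \<open>v\<close>, \<open>k\<close>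
  and \<open>i\<close> it has three vertices, which must be the three other out-neighbours of
  \<open>v\<close>. So \<open>S\<close> is determined by \<open>k\<close> and \<open>i\<close>, with
  two choices each.\<close>

lemma card_initial_not_balanced:
  assumes "v \<in> V" "\<not> balanced v"
  shows "card {S \<in> Tr. on_initial_cycle E v S} \<le> 4"
proof -
  let ?O = "{u. E v u}"
  obtain j z where j: "E v j" "E v (mate j)" and z: "E z v" "E (mate z) v"
    using not_balancedE assms by metis
  have V: "j \<in> V" "z \<in> V"
    using j z E_in by auto
  let ?f = "\<lambda>(k, i). {v, k, i} \<union> (?O - {j, mate j})"
  let ?D = "{z, mate z} \<times> {j, mate j}"
  have "{S \<in> Tr. on_initial_cycle E v S} \<subseteq> ?f ` ?D"
  proof
    fix S assume "S \<in> {S \<in> Tr. on_initial_cycle E v S}"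
    then have S: "S \<in> Tr" and "on_initial_cycle E v S"
      by auto
    then obtain x k where xk: "{v, x, k} \<subseteq> S" "E v x" "E x k" "E k v"
      and dom: "\<forall>y\<in>S - {v, x, k}. E v y \<and> E x y \<and> E k y"
      by (auto simp: on_initial_cycle_def)
    have out: "E v y" if "y \<in> S - {v, k}" for y
      using that dom xk by auto
    have "z \<noteq> v" "mate z \<noteq> v"
      using z E_in by auto
    then have k: "k \<in> {z, mate z}"
      using TrD(2)[OF S \<open>z \<in> V\<close>] out z E_asym by blast
    obtain i where i: "i \<in> {j, mate j}" "i \<in> S" and ni: "S \<inter> {j, mate j} = {i}"
      using TrD(2)[OF S \<open>j \<in> V\<close>] by auto
    have "E v i"
      using j i by blast
    then have distinct: "v \<noteq> k" "v \<noteq> i" "k \<noteq> i"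
      using E_in[OF \<open>E k v\<close>] E_in[OF \<open>E v i\<close>] E_asym[OF \<open>E k v\<close>] by auto
    have "S - {v, k, i} \<subseteq> ?O - {j, mate j}"
      using out ni by auto
    moreover have "card (S - {v, k, i}) = 3"
      using card_Tr_elem[OF S] TrD(3)[OF S] xk(1) i distinct by (subst card_Diff_subset) auto
    moreover have "card (?O - {j, mate j}) = 3"
      using card_out[OF \<open>v \<in> V\<close>] j mate_neq[OF \<open>j \<in> V\<close>] finite_out
      by (subst card_Diff_subset) auto
    ultimately have "S - {v, k, i} = ?O - {j, mate j}"
      using finite_out by (intro card_subset_eq) auto
    then have "S = ?f (k, i)"
      using xk(1) i unfolding prod.case by blast
    then show "S \<in> ?f ` ?D"
      using k i by blast
  qed
  then have "card {S \<in> Tr. on_initial_cycle E v S} \<le> card ?D"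
    by (rule surj_card_le[rotated]) simp
  also have "\<dots> \<le> 4"
    by (simp add: card_cartesian_product card_insert_if)
  finally show ?thesis .
qed

text \<open>The constants are \<open>6 * 1 + 2\<close> and \<open>6 * 0 + 4\<close>.\<close>

lemma initial_weight:
  assumes "v \<in> V"
  shows "6 * card {S \<in> Tr. source E v S} + card {S \<in> Tr. on_initial_cycle E v S}
    \<le> (if balanced v then 8 else 4)"
proof (cases "balanced v")
  case True
  then show ?thesis
    using card_sources[of v] card_initial_balanced[OF assms] by simp
next
  case False
  then have "card {S \<in> Tr. source E v S} = 0"
    using not_balanced_no_source[OF assms] by (simp add: card_eq_0_iff)
  then show ?thesis
    using card_initial_not_balanced[OF assms False] False by simp
qed

text \<open>This puts a vertex in the same case of the weight bound for \<open>E\<close> and for its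
  converse.\<close>

lemma converse_balanced:
  assumes "v \<in> V"
  shows "regular_bipaired_tournament.balanced V mate E\<inverse>\<inverse> v = balanced v"
proof -
  interpret dual: regular_bipaired_tournament V mate "E\<inverse>\<inverse>"
    by (rule converse_regular_bipaired_tournament)
  show ?thesis
    unfolding balanced_def dual.balanced_def
    using mate_in_Diff[OF assms] mate_mate by (metis DiffD1 conversep_iff)
qed

section \<open>Weights of non-strong transversals\<close>

text \<open>A source of \<open>Q\<close> also dominates \<open>S - Q\<close>, so it is a source of
  \<open>S\<close>; dually, a sink of \<open>S - Q\<close> is a sink of \<open>S\<close>. If
  \<open>S\<close> has neither, both sides have at least three vertices, hence exactly three, and
  both are cyclic triangles.\<close>

lemma not_strong_cases:
  assumes S: "S \<in> Tr" and "dominance_split E S"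
  shows "(\<exists>v\<in>S. source E v S) \<or> (\<exists>v\<in>S. source E\<inverse>\<inverse> v S) \<or>
    (\<exists>Q\<subseteq>S. card Q = 3 \<and> (\<forall>v\<in>Q. on_initial_cycle E v S) \<and>
      (\<forall>v\<in>S - Q. on_initial_cycle E\<inverse>\<inverse> v S))"
proof -
  obtain Q where Q: "Q \<noteq> {}" "Q \<subset> S" and dom: "\<And>x y. x \<in> Q \<Longrightarrow> y \<in> S - Q \<Longrightarrow> E x y"
    using assms by (auto simp: dominance_split_def)
  have tour: "E u v \<noteq> E v u" if "u \<in> S" "v \<in> S" "u \<noteq> v" for u v
    using E_xor[of u v] TrD[OF S] that by blast
  show ?thesis
  proof (cases "(\<exists>v\<in>S. source E v S) \<or> (\<exists>v\<in>S. source E\<inverse>\<inverse> v S)")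
    case False
    have Q_source: "\<not> source E v Q" for v
    proof
      assume v: "source E v Q"
      have "v \<in> S"
        using v Q by (auto simp: source_def)
      moreover have "E v y" if "y \<in> S - {v}" for y
        using v dom[of v y] that by (cases "y \<in> Q") (auto simp: source_def)
      ultimately have "v \<in> S" "source E v S"
        unfolding source_def by blast+
      with False show False
        by blast
    qed
    have SQ_source: "\<not> source E\<inverse>\<inverse> v (S - Q)" for v
    proof
      assume v: "source E\<inverse>\<inverse> v (S - Q)"
      have "v \<in> S"
        using v by (auto simp: source_def)
      moreover have "E\<inverse>\<inverse> v y" if "y \<in> S - {v}" for y
        using v dom[of y v] that by (cases "y \<in> Q") (auto simp: source_def)
      ultimately have "v \<in> S" "source E\<inverse>\<inverse> v S"
        unfolding source_def by blast+
      with False show False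
        by blast
    qed
    have fin: "finite Q" "finite (S - Q)"
      using TrD(3)[OF S] Q by (auto intro: finite_subset)
    have tour_Q: "E u v \<noteq> E v u" if "u \<in> Q" "v \<in> Q" "u \<noteq> v" for u v
      using tour[of u v] Q that by auto
    have tour_SQ: "E\<inverse>\<inverse> u v \<noteq> E\<inverse>\<inverse> v u" if "u \<in> S - Q" "v \<in> S - Q" "u \<noteq> v" for u v
      using tour[of v u] that by auto
    have SQ: "S - Q \<noteq> {}"
      using Q by auto
    have "3 \<le> card Q"
      by (rule card_ge_3_if_no_source[OF fin(1) Q(1) tour_Q Q_source])
    moreover have "3 \<le> card (S - Q)"
      by (rule card_ge_3_if_no_source[OF fin(2) SQ tour_SQ SQ_source])
    moreover have "card (S - Q) = card S - card Q"
      using Q fin by (intro card_Diff_subset) auto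
    ultimately have card: "card Q = 3" "card (S - Q) = 3"
      using card_Tr_elem[OF S] by linarith+
    have "on_initial_cycle E v S" if v: "v \<in> Q" for v
    proof -
      obtain x k where "Q = {v, x, k}" "E v x" "E x k" "E k v"
        by (rule cyclic_triple_if_no_source[OF card(1) v tour_Q Q_source])
      moreover have "{v, x, k} \<subseteq> S" "\<And>q y. q \<in> {v, x, k} \<Longrightarrow> y \<in> S - {v, x, k} \<Longrightarrow> E q y"
        using Q dom \<open>Q = {v, x, k}\<close> by blast+
      ultimately show ?thesis
        by (intro on_initial_cycleI)
    qed
    moreover have "on_initial_cycle E\<inverse>\<inverse> v S" if v: "v \<in> S - Q" for v
    proof -
      obtain x k where "S - Q = {v, x, k}" "E\<inverse>\<inverse> v x" "E\<inverse>\<inverse> x k" "E\<inverse>\<inverse> k v"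
        by (rule cyclic_triple_if_no_source[OF card(2) v tour_SQ SQ_source])
      moreover have "{v, x, k} \<subseteq> S" "S - {v, x, k} \<subseteq> Q"
        using \<open>S - Q = {v, x, k}\<close> by blast+
      moreover have "E\<inverse>\<inverse> q y" if "q \<in> {v, x, k}" "y \<in> S - {v, x, k}" for q y
        using dom[of y q] that \<open>S - Q = {v, x, k}\<close> \<open>S - {v, x, k} \<subseteq> Q\<close> by blast
      ultimately show ?thesis
        by (intro on_initial_cycleI)
    qed
    ultimately show ?thesis
      using Q card by blast
  qed blast
qed

text \<open>The two halves have the form bounded in \<open>initial_weight\<close>, once for
  \<open>E\<close> and once for its converse.\<close>

definition weight :: "'a set \<Rightarrow> 'a \<Rightarrow> nat" where
  "weight S v =
     6 * of_bool (source E v S) + of_bool (on_initial_cycle E v S) +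
     (6 * of_bool (source E\<inverse>\<inverse> v S) + of_bool (on_initial_cycle E\<inverse>\<inverse> v S))"

lemma not_strong_weight:
  assumes S: "S \<in> Tr" and "dominance_split E S"
  shows "6 \<le> (\<Sum>v\<in>V. weight S v)"
proof -
  have "S \<subseteq> V" "finite S"
    using TrD[OF S] by auto
  have single: ?thesis if "v \<in> S" "6 \<le> weight S v" for v
    using that member_le_sum[of v V "weight S"] \<open>S \<subseteq> V\<close> finite_V by fastforce
  consider v where "v \<in> S" "source E v S" | v where "v \<in> S" "source E\<inverse>\<inverse> v S"
    | Q where "Q \<subseteq> S" "card Q = 3" "\<forall>v\<in>Q. on_initial_cycle E v S"
      "\<forall>v\<in>S - Q. on_initial_cycle E\<inverse>\<inverse> v S"
    using not_strong_cases[OF assms] by blast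
  then show ?thesis
  proof cases
    case 3
    \<comment> \<open>Each of the six vertices lies on one of the two triangles and contributes at
      least 1.\<close>
    have "(\<Sum>v\<in>S. 1) \<le> (\<Sum>v\<in>S. weight S v)"
      using 3 by (intro sum_mono) (auto simp: weight_def)
    also have "\<dots> \<le> (\<Sum>v\<in>V. weight S v)"
      using \<open>S \<subseteq> V\<close> finite_V by (intro sum_mono2) auto
    finally show ?thesis
      using card_Tr_elem[OF S] by simp
  qed (use single in \<open>auto simp: weight_def\<close>)
qed

lemma sum_weight_le:
  assumes "v \<in> V"
  shows "(\<Sum>S\<in>Tr. weight S v) \<le> (if balanced v then 16 else 8)"
proof -
  interpret dual: regular_bipaired_tournament V mate "E\<inverse>\<inverse>"
    by (rule converse_regular_bipaired_tournament)
  have count: "(\<Sum>S\<in>Tr. of_bool (p S)) = card {S \<in> Tr. p S}" for p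
    using finite_Tr by (simp add: Collect_conj_eq Int_commute)
  have "(\<Sum>S\<in>Tr. weight S v) =
      6 * card {S \<in> Tr. source E v S} + card {S \<in> Tr. on_initial_cycle E v S} +
      (6 * card {S \<in> Tr. source E\<inverse>\<inverse> v S} + card {S \<in> Tr. on_initial_cycle E\<inverse>\<inverse> v S})"
    unfolding weight_def sum.distrib sum_distrib_left[symmetric] count ..
  then show ?thesis
    using initial_weight[OF assms] dual.initial_weight[OF assms] converse_balanced[OF assms]
    by (auto split: if_splits)
qed

section \<open>Counting non-strong transversals\<close>

abbreviation "Bad \<equiv> {S \<in> Tr. dominance_split E S}"

text \<open>Double counting of the total weight over transversals and vertices.\<close>

lemma card_Bad_le: "6 * card Bad \<le> (\<Sum>v\<in>V. if balanced v then 16 else 8)"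
proof -
  have "6 * card Bad = (\<Sum>S\<in>Bad. 6)"
    by simp
  also have "\<dots> \<le> (\<Sum>S\<in>Bad. \<Sum>v\<in>V. weight S v)"
    using not_strong_weight by (intro sum_mono) auto
  also have "\<dots> \<le> (\<Sum>S\<in>Tr. \<Sum>v\<in>V. weight S v)"
    using finite_Tr by (intro sum_mono2) auto
  also have "\<dots> = (\<Sum>v\<in>V. \<Sum>S\<in>Tr. weight S v)"
    by (rule sum.swap)
  also have "\<dots> \<le> (\<Sum>v\<in>V. if balanced v then 16 else 8)"
    using sum_weight_le by (intro sum_mono) auto
  finally show ?thesis .
qed

lemma source_split:
  assumes "S \<in> Tr" "source E v S"
  shows "dominance_split E S"
proof -
  have "S \<noteq> {v}"
    using card_Tr_elem[OF \<open>S \<in> Tr\<close>] by auto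
  then show ?thesis
    using assms unfolding dominance_split_def source_def by (intro exI[of _ "{v}"]) auto
qed

text \<open>For any \<open>v\<close>, balance at \<open>v\<close> makes \<open>v\<close> with its
  out-neighbours a transversal. The complement consists of \<open>mate v\<close> and the
  in-neighbours of \<open>v\<close>, and \<open>mate v\<close> is its source.\<close>

lemma all_balanced_bad_pair:
  assumes "\<forall>v\<in>V. balanced v"
  shows "\<exists>T\<in>Bad. V - T \<in> Bad"
proof -
  obtain v where v: "v \<in> V"
    using card_V by fastforce
  have bal: "E w u \<longleftrightarrow> E (mate u) w" if "w \<in> V" "u \<in> V - {w, mate w}" for w u
    using assms that by (auto simp: balanced_def)
  define T where "T = insert v {u. E v u}"
  have T: "T \<in> Tr"
    unfolding transversals_def
  proof (intro CollectI conjI ballI)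
    show "T \<subseteq> V"
      using v E_in by (auto simp: T_def)
    fix u assume "u \<in> V"
    consider "u = v" | "u = mate v" | "u \<in> V - {v, mate v}"
      using \<open>u \<in> V\<close> by blast
    then show "u \<in> T \<longleftrightarrow> mate u \<notin> T"
    proof cases
      case 3
      then have "mate u \<in> V - {v, mate v}"
        by (rule mate_in_Diff[OF v])
      then show ?thesis
        using 3 bal[OF v 3] E_not_out[OF v] by (auto simp: T_def)
    qed (use v E_in mate_mate mate_neq in \<open>auto simp: T_def\<close>)
  qed
  have "source E v T"
    by (auto simp: source_def T_def)
  moreover have "source E (mate v) (V - T)"
    unfolding source_def
  proof (intro conjI ballI)
    show "mate v \<in> V - T"
      using v mate_in mate_neq E_in by (auto simp: T_def)
    fix y assume "y \<in> V - T - {mate v}"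
    then have y: "y \<in> V - {v, mate v}" and "\<not> E v y"
      by (auto simp: T_def)
    then have "E y v"
      using E_not_out[OF v] by blast
    \<comment> \<open>Here the balance of \<open>y\<close> is used: it dominates \<open>v\<close>,
      so \<open>mate v\<close> dominates it.\<close>
    then show "E (mate v) y"
      using bal[of y v] y v mate_eq_iff by auto
  qed
  ultimately show ?thesis
    using T Diff_in_Tr[OF T] source_split by blast
qed

lemma complementary_strong_transversals:
  "\<exists>S\<in>Tr. \<not> dominance_split E S \<and> \<not> dominance_split E (V - S)"
proof (rule ccontr)
  assume contra: "\<not> ?thesis"
  have cover: "S \<in> Bad \<or> V - S \<in> Bad" if "S \<in> Tr" for S
    using contra that Diff_in_Tr[OF that] by auto
  have compl: "V - (V - S) = S" if "S \<in> Tr" for S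
    using TrD(1)[OF that] by blast
  have "finite Bad"
    using finite_Tr by simp
  \<comment> \<open>Used with \<open>B\<close> equal to \<open>Bad\<close> and to \<open>Bad\<close>
    without one element.\<close>
  have bound: "64 \<le> card Bad + card B" if "B \<subseteq> Bad" "Tr \<subseteq> Bad \<union> (\<lambda>S. V - S) ` B" for B
  proof -
    have "finite B"
      using that \<open>finite Bad\<close> finite_subset by blast
    then have "card Tr \<le> card (Bad \<union> (\<lambda>S. V - S) ` B)"
      using that \<open>finite Bad\<close> by (intro card_mono) auto
    also have "\<dots> \<le> card Bad + card ((\<lambda>S. V - S) ` B)"
      by (rule card_Un_le)
    also have "\<dots> \<le> card Bad + card B"
      using card_image_le[OF \<open>finite B\<close>] by simp
    finally show ?thesis
      using card_Tr_ge by simp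
  qed
  show False
  proof (cases "\<forall>v\<in>V. balanced v")
    case True
    then obtain T where T: "T \<in> Bad" "V - T \<in> Bad"
      using all_balanced_bad_pair by blast
    \<comment> \<open>\<open>T\<close> can be left out, since the only transversal it would cover,
      \<open>V - T\<close>, is itself in \<open>Bad\<close>. This contradicts
      \<open>card Bad \<le> 32\<close>, as 32 + 31 < 64.\<close>
    have "Tr \<subseteq> Bad \<union> (\<lambda>S. V - S) ` (Bad - {T})"
    proof
      fix S assume S: "S \<in> Tr"
      show "S \<in> Bad \<union> (\<lambda>S. V - S) ` (Bad - {T})"
      proof (cases "S \<in> Bad")
        case False
        then have "V - S \<in> Bad" "V - S \<noteq> T"
          using cover[OF S] T compl[OF S] by auto
        then show ?thesis
          using compl[OF S] by (intro UnI2 image_eqI[of _ _ "V - S"]) auto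
      qed blast
    qed
    then have "64 \<le> card Bad + card (Bad - {T})"
      by (intro bound) auto
    moreover have "card (Bad - {T}) < card Bad"
      using \<open>finite Bad\<close> T(1) by (rule card_Diff1_less)
    moreover have "6 * card Bad \<le> 16 * 12"
      using card_Bad_le True card_V by simp
    ultimately show False
      by linarith
  next
    case False
    then obtain w where w: "w \<in> V" "\<not> balanced w"
      by blast
    have "Tr \<subseteq> Bad \<union> (\<lambda>S. V - S) ` Bad"
    proof
      fix S assume S: "S \<in> Tr"
      show "S \<in> Bad \<union> (\<lambda>S. V - S) ` Bad"
        using cover[OF S]
      proof
        assume "V - S \<in> Bad"
        then show ?thesis
          using compl[OF S] by (intro UnI2 image_eqI[of _ _ "V - S"]) auto
      qed blast
    qed
    then have "64 \<le> card Bad + card Bad"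
      by (intro bound) auto
    \<comment> \<open>The vertex \<open>w\<close> makes the total strictly smaller than 192, so
      \<open>Bad\<close> has at most 31 elements.\<close>
    moreover have "(\<Sum>v\<in>V. if balanced v then 16 else 8) < (\<Sum>v\<in>V. 16 :: nat)"
      using w finite_V by (intro sum_strict_mono_ex1) auto
    then have "6 * card Bad < 16 * 12"
      using card_Bad_le card_V by simp
    ultimately show False
      by linarith
  qed
qed

end

section \<open>Strong connectivity and degrees in digraphs\<close>

lemma dominates_induce_subgraph_iff:
  "u \<rightarrow>\<^bsub>G \<restriction> S\<^esub> v \<longleftrightarrow> u \<in> S \<and> v \<in> S \<and> u \<rightarrow>\<^bsub>G\<^esub> v"
  unfolding arcs_ends_conv image_iff by auto

text \<open>No arc leaves the set \<open>R\<close> of vertices reachable from \<open>u\<close>, so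
  in a tournament every vertex outside \<open>R\<close> dominates \<open>R\<close>. As
  \<open>u\<close> lies in \<open>R\<close>, a nonempty outside would be a split.\<close>

lemma strongly_connected_if_no_split:
  assumes "tournament T" "verts T \<noteq> {}" "\<not> dominance_split (dominates T) (verts T)"
  shows "strongly_connected T"
proof (rule strongly_connectedI)
  interpret digraph T
    using assms by (simp add: tournament_def)
  fix u v assume u: "u \<in> verts T" and v: "v \<in> verts T"
  define R where "R = {w \<in> verts T. u \<rightarrow>\<^sup>*\<^bsub>T\<^esub> w}"
  have "x \<rightarrow>\<^bsub>T\<^esub> y" if "x \<in> verts T - R" "y \<in> R" for x y
  proof -
    have "\<not> y \<rightarrow>\<^bsub>T\<^esub> x"
      using that reachable_adj_trans[of u y x] by (auto simp: R_def)
    moreover have "x \<in> verts T" "y \<in> verts T" "x \<noteq> y"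
      using that by (auto simp: R_def)
    then have "(x \<rightarrow>\<^bsub>T\<^esub> y) \<noteq> (y \<rightarrow>\<^bsub>T\<^esub> x)"
      using assms(1) unfolding tournament_def by blast
    ultimately show ?thesis
      by simp
  qed
  moreover have "u \<in> R"
    using u by (simp add: R_def)
  moreover have "verts T - (verts T - R) = R"
    by (auto simp: R_def)
  moreover have "verts T - R \<noteq> verts T"
    using \<open>u \<in> R\<close> u by blast
  ultimately have "verts T - R = {}"
    using assms(3) unfolding dominance_split_def by (metis Diff_subset psubsetI)
  then show "u \<rightarrow>\<^sup>*\<^bsub>T\<^esub> v"
    using v by (auto simp: R_def)
qed (use assms in auto)

text \<open>Without parallel arcs, an arc into \<open>v\<close> is determined by its tail.\<close>

lemma (in digraph) in_degree_eq_card: "in_degree G v = card {u. u \<rightarrow> v}"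
proof -
  have "{u. u \<rightarrow> v} = tail G ` in_arcs G v"
    unfolding arcs_ends_conv in_arcs_def image_def by auto
  moreover have "inj_on (tail G) (in_arcs G v)"
    by (intro inj_onI no_multi_arcs) (auto simp: in_arcs_def arc_to_ends_def)
  ultimately show ?thesis
    by (simp add: in_degree_def card_image)
qed

lemma (in digraph) out_degree_eq_card: "out_degree G v = card {u. v \<rightarrow> u}"
proof -
  have "{u. v \<rightarrow> u} = head G ` out_arcs G v"
    unfolding arcs_ends_conv out_arcs_def image_def by auto
  moreover have "inj_on (head G) (out_arcs G v)"
    by (intro inj_onI no_multi_arcs) (auto simp: out_arcs_def arc_to_ends_def)
  ultimately show ?thesis
    by (simp add: out_degree_def card_image)
qed

section \<open>Transfer to the multipartite tournament\<close>

theorem theorem4p4: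
  fixes G :: "('a, 'b) pre_digraph" and P :: "'a set set"
  assumes "balanced_multipartite_tournament 2 6 G P"
    and "regular_digraph G"
  shows "\<exists>T1 T2. strong_partition G P T1 T2"
proof -
  have G: "digraph G" and P: "partition_on (verts G) P" "card P = 6" "\<And>X. X \<in> P \<Longrightarrow> card X = 2"
    and no_arc: "\<And>X u v. X \<in> P \<Longrightarrow> u \<in> X \<Longrightarrow> v \<in> X \<Longrightarrow> \<not> u \<rightarrow>\<^bsub>G\<^esub> v"
    and xor: "\<And>X Y u v. X \<in> P \<Longrightarrow> Y \<in> P \<Longrightarrow> X \<noteq> Y \<Longrightarrow> u \<in> X \<Longrightarrow> v \<in> Y \<Longrightarrow>
      (u \<rightarrow>\<^bsub>G\<^esub> v) \<noteq> (v \<rightarrow>\<^bsub>G\<^esub> u)"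
    using assms(1) unfolding balanced_multipartite_tournament_def multipartite_tournament_def
    by blast+
  interpret digraph G
    by (rule G)
  let ?V = "verts G"
  note union = partition_onD1[OF P(1), symmetric]
  have disj: "X \<inter> Y = {}" if "X \<in> P" "Y \<in> P" "X \<noteq> Y" for X Y
    using partition_onD2[OF P(1)] that by (rule disjointD)
  have "\<exists>w. {v, w} \<in> P \<and> w \<noteq> v" if v: "v \<in> ?V" for v
  proof -
    obtain X where X: "X \<in> P" "v \<in> X"
      using v unfolding union[symmetric] ..
    then obtain a b where "X = {a, b}" "a \<noteq> b"
      using P(3) by (meson card_2_iff)
    with X have "{v, b} \<in> P \<and> b \<noteq> v \<or> {v, a} \<in> P \<and> a \<noteq> v"
      by (auto simp: insert_commute)
    then show ?thesis
      by blast
  qed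
  then obtain mate where mate: "\<And>v. v \<in> ?V \<Longrightarrow> {v, mate v} \<in> P" "\<And>v. v \<in> ?V \<Longrightarrow> mate v \<noteq> v"
    by metis
  have in_V: "v \<in> ?V" if "X \<in> P" "v \<in> X" for X v
    unfolding union[symmetric] using that by (rule UnionI)
  have part: "X = {v, mate v}" if "X \<in> P" "v \<in> X" for X v
    using that disj[OF that(1) mate(1)[OF in_V[OF that]]] by auto
  have mate_in: "mate v \<in> ?V" if "v \<in> ?V" for v
    using in_V[OF mate(1)[OF that]] by simp
  have card_V: "card ?V = 12"
  proof -
    have "card (\<Union>P) = (\<Sum>X\<in>P. card X)"
      using P disj by (intro card_Union_disjoint)
        (auto simp: pairwise_def disjnt_def intro: card_ge_0_finite)
    then show ?thesis
      using P union by simp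
  qed
  have E_xor: "(u \<rightarrow>\<^bsub>G\<^esub> v) \<noteq> (v \<rightarrow>\<^bsub>G\<^esub> u)"
    if "u \<in> ?V" "v \<in> ?V" "v \<noteq> u" "v \<noteq> mate u" for u v
    using xor[OF mate(1)[OF that(1)] mate(1)[OF that(2)], of u v] that by blast
  \<comment> \<open>The part \<open>{v, mate v}\<close> is also the part
    \<open>{mate v, mate (mate v)}\<close> of its second element.\<close>
  have mate_mate: "mate (mate v) = v" if "v \<in> ?V" for v
    using part[OF mate(1)[OF that], of "mate v"] mate(2)[OF that] by (auto simp: doubleton_eq_iff)
  have E_in: "u \<in> ?V \<and> v \<in> ?V \<and> v \<noteq> u \<and> v \<noteq> mate u" if "u \<rightarrow>\<^bsub>G\<^esub> v" for u v
    using that no_arc[OF mate(1)[of u], of u v] adj_in_verts[OF that] by auto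
  \<comment> \<open>In- and out-neighbours partition the ten vertices outside the part of
    \<open>v\<close>, and regularity halves this number.\<close>
  have deg: "card {u. v \<rightarrow>\<^bsub>G\<^esub> u} = 5" "card {u. u \<rightarrow>\<^bsub>G\<^esub> v} = 5" if v: "v \<in> ?V" for v
  proof -
    let ?O = "{u. v \<rightarrow>\<^bsub>G\<^esub> u}" and ?I = "{u. u \<rightarrow>\<^bsub>G\<^esub> v}"
    have "u \<in> ?O \<union> ?I \<longleftrightarrow> u \<in> ?V - {v, mate v}" for u
      using E_in[of v u] E_in[of u v] E_xor[of v u] v mate_mate[OF v] by auto
    then have "?O \<union> ?I = ?V - {v, mate v}"
      by blast
    moreover have "u \<notin> ?O \<or> u \<notin> ?I" for u
      using E_in[of v u] E_xor[of v u] v by blast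
    then have "?O \<inter> ?I = {}"
      by blast
    moreover have "finite ?O" "finite ?I"
      using adj_in_verts finite_verts by (auto intro: finite_subset[of _ ?V])
    ultimately have "card ?O + card ?I = card (?V - {v, mate v})"
      by (metis card_Un_disjoint)
    moreover have "card (?V - {v, mate v}) = 10"
      using card_V v mate(2)[OF v] mate_in[OF v] by (subst card_Diff_subset) auto
    moreover have "card ?I = card ?O"
      using assms(2) v in_degree_eq_card out_degree_eq_card by (auto simp: regular_digraph_def)
    ultimately show "card ?O = 5" "card ?I = 5"
      by linarith+
  qed
  interpret regular_bipaired_tournament ?V mate "dominates G"
    by unfold_locales (fact card_V mate_in mate_mate mate(2) E_in E_xor deg)+
  obtain S where S: "S \<in> Tr" "\<not> dominance_split (dominates G) S"
      "\<not> dominance_split (dominates G) (?V - S)"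
    using complementary_strong_transversals by blast
  have ok: "maximal_tournament G P (G \<restriction> S) \<and> strongly_connected (G \<restriction> S)"
    if S: "S \<in> Tr" "\<not> dominance_split (dominates G) S" for S
  proof -
    have "S \<subseteq> ?V"
      using TrD[OF S(1)] by blast
    have "digraph (G \<restriction> S)"
      using \<open>S \<subseteq> ?V\<close> by (intro digraphI_induced induced_induce)
    moreover have "(u \<rightarrow>\<^bsub>G\<^esub> v) \<noteq> (v \<rightarrow>\<^bsub>G\<^esub> u)" if "u \<in> S" "v \<in> S" "u \<noteq> v" for u v
      using E_xor[of u v] TrD(2)[OF S(1), of u] \<open>S \<subseteq> ?V\<close> that by blast
    ultimately have tour: "tournament (G \<restriction> S)"
      unfolding tournament_def induce_subgraph_verts dominates_induce_subgraph_iff by blast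
    have "card (S \<inter> X) = 1" if "X \<in> P" for X
    proof -
      have "X \<noteq> {}"
        using P(3)[OF that] by auto
      then obtain v where v: "v \<in> X"
        by blast
      then have "X = {v, mate v}" "v \<in> ?V"
        using part union that by auto
      then have "S \<inter> X = {v} \<or> S \<inter> X = {mate v}"
        using TrD(2)[OF S(1), of v] by blast
      then show ?thesis
        by auto
    qed
    then have "maximal_tournament G P (G \<restriction> S)"
      unfolding maximal_tournament_def
      using tour card_Tr_elem[OF S(1)] P(2) \<open>S \<subseteq> ?V\<close>
      by (auto intro: subgraph_induce_subgraphI induced_imp_subgraph induced_induce)
    \<comment> \<open>A split of \<open>S\<close> compares only vertices of \<open>S\<close>, where
      both arc relations agree.\<close>
    moreover have "\<not> dominance_split (dominates (G \<restriction> S)) S"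
      using S(2) unfolding dominance_split_def dominates_induce_subgraph_iff by blast
    moreover have "S \<noteq> {}"
      using card_Tr_elem[OF S(1)] by auto
    ultimately show ?thesis
      using strongly_connected_if_no_split[OF tour] by simp
  qed
  have "strong_partition G P (G \<restriction> S) (G \<restriction> (?V - S))"
    using ok[OF S(1,2)] ok[OF Diff_in_Tr[OF S(1)] S(3)] TrD(1)[OF S(1)]
    unfolding strong_partition_def maximal_tournament_partition_def by auto
  then show ?thesis
    by blast
qed

end
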